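(* For every partial sign matrix $A\in\{-1,1,*\}^{M\times N}$, $$\operatorname{ind}^{\mathrm{lin}}_{\mathbb{Z}_2}(S(A))=\operatorname{rank}^{\pm}(A)-1 .$$
   Context: The sign-rank $\operatorname{rank}^{\pm}(A)$ of a partial sign matrix $A\in\{-1,1,*\}^{M\times N}$ is the smallest integer $d$ for which there exist nonzero vectors $u_1,\dots,u_M\in\mathbb{R}^d$ and $v_1,\dots,v_N\in\mathbb{R}^d$ such that $\operatorname{sign}(\langle u_i,v_j\rangle)=A_{ij}$ for every $(i,j)$ with $A_{ij}\in\{-1,1\}$. Sign complex. For $A\in\{-1,1,*\}^{M\times N}$ and each row $r$ of $A$, let $\sigma_r^+=\{i^+: r_i=+1\}\cup\{i^-: r_i=-1\}$ and $\sigma_r^-=\{i^-: r_i=+1\}\cup\{i^+: r_i=-1\}$, subsets of $\{1^+,1^-,\dots,N^+,N^-\}$. The sign complex $S(A)$ is the abstract simplicial complex whose simplices are all subsets of $\sigma_r^+$ or $\sigma_r^-$ over all rows $r$. The involution $i^+\leftrightarrow i^-$ is a free simplicial $\mathbb{Z}_2$-action on $S(A)$. Its geometric realization is $|S(A)|=\bigcup_{\sigma\in S(A)}\operatorname{conv}\{\phi(v):v\in\sigma\}\subset\mathbb{R}^N$, where $\phi(i^+)=e_i$, $\phi(i^-)=-e_i$ and $e_1,\dots,e_N$ is the standard basis; the involution becomes $x\mapsto -x$. Linear index. For a free $\mathbb{Z}_2$-complex $K$ realized in this way as $|K|\subset\mathbb{R}^N$, $\operatorname{ind}^{\mathrm{lin}}_{\mathbb{Z}_2}(K)$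 is the minimum $d\ge 0$ for which there is a linear map $g:\mathbb{R}^N\to\mathbb{R}^{d+1}$ with $0\notin g(|K|)$. *)

theory Defs
  imports "HOL-Analysis.Analysis" "Jordan_Normal_Form.Matrix"
begin

text \<open>
  The ambient space of the realization, with one axis per column, is \<open>real ^ 'n\<close>. Spaces whose
  dimension \<open>d\<close> is minimised over cannot be types; they are \<open>carrier_vec d\<close>.
\<close>

no_notation inner (infix "\<bullet>" 70)

datatype entry = Pos | Neg | Star

type_synonym ('m, 'n) partial_sign_matrix = "'m \<Rightarrow> 'n \<Rightarrow> entry"

definition sign_realizes ::
    "('m, 'n) partial_sign_matrix \<Rightarrow> nat \<Rightarrow> ('m \<Rightarrow> real Matrix.vec) \<Rightarrow> ('n \<Rightarrow> real Matrix.vec) \<Rightarrow> bool"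
  where
  "sign_realizes A d u v \<longleftrightarrow>
     (\<forall>i. u i \<in> carrier_vec d \<and> u i \<noteq> 0\<^sub>v d) \<and>
     (\<forall>j. v j \<in> carrier_vec d \<and> v j \<noteq> 0\<^sub>v d) \<and>
     (\<forall>i j. (A i j = Pos \<longrightarrow> sgn (u i \<bullet> v j) = 1) \<and>
            (A i j = Neg \<longrightarrow> sgn (u i \<bullet> v j) = -1))"

definition sign_rank :: "('m::finite, 'n::finite) partial_sign_matrix \<Rightarrow> nat" where
  "sign_rank A = (LEAST d. \<exists>u v. sign_realizes A d u v)"

datatype 'n vertex = Plus 'n | Minus 'n

definition sigma_plus :: "('m, 'n) partial_sign_matrix \<Rightarrow> 'm \<Rightarrow> 'n vertex set" where
  "sigma_plus A r = {Plus i | i. A r i = Pos} \<union> {Minus i | i. A r i = Neg}"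

definition sigma_minus :: "('m, 'n) partial_sign_matrix \<Rightarrow> 'm \<Rightarrow> 'n vertex set" where
  "sigma_minus A r = {Minus i | i. A r i = Pos} \<union> {Plus i | i. A r i = Neg}"

definition sign_complex :: "('m, 'n) partial_sign_matrix \<Rightarrow> 'n vertex set set" where
  "sign_complex A = {s. \<exists>r. s \<subseteq> sigma_plus A r \<or> s \<subseteq> sigma_minus A r}"

fun vertex_pos :: "'n::finite vertex \<Rightarrow> real ^ 'n" where
  "vertex_pos (Plus i) = axis i 1"
| "vertex_pos (Minus i) = - axis i 1"

definition realization :: "'n::finite vertex set set \<Rightarrow> (real ^ 'n) set" where
  "realization K = (\<Union>s\<in>K. convex hull (vertex_pos ` s))"

definition linear_into :: "nat \<Rightarrow> (real ^ 'n::finite \<Rightarrow> real Matrix.vec) \<Rightarrow> bool" where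
  "linear_into k g \<longleftrightarrow>
     (\<forall>x. g x \<in> carrier_vec k) \<and>
     (\<forall>x y. g (x + y) = g x + g y) \<and>
     (\<forall>c x. g (c *\<^sub>R x) = c \<cdot>\<^sub>v g x)"

text \<open>
  The minimum exists for any \<open>K\<close> with \<open>0 \<notin> realization K\<close>; for sign complexes see
  \<open>lin_index_attained\<close> below.
\<close>

definition lin_index :: "'n::finite vertex set set \<Rightarrow> nat" where
  "lin_index K = (LEAST d. \<exists>g. linear_into (d + 1) g \<and> 0\<^sub>v (d + 1) \<notin> g ` realization K)"

lemma sign_rank_attained:
  fixes A :: "('m::finite, 'n::finite) partial_sign_matrix"
  shows "\<exists>u v. sign_realizes A (sign_rank A) u v"
proof -
  let ?N = "CARD('n)"
  obtain f :: "nat \<Rightarrow> 'n" where f: "bij_betw f {0..<?N} UNIV"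
    using ex_bij_betw_nat_finite[of "UNIV :: 'n set"] by auto
  define e :: "'m \<Rightarrow> 'n \<Rightarrow> real" where
    "e i j = (case A i j of Pos \<Rightarrow> 1 | Neg \<Rightarrow> -1 | Star \<Rightarrow> 0)" for i j
  define u where "u i = Matrix.vec (?N + 1) (\<lambda>k. if k < ?N then e i (f k) else 1)" for i
  define v :: "'n \<Rightarrow> real Matrix.vec" where
    "v j = Matrix.vec (?N + 1) (\<lambda>k. if k < ?N \<and> f k = j then 1 else 0)" for j
  have u0: "u i \<noteq> 0\<^sub>v (?N + 1)" for i
  proof
    assume "u i = 0\<^sub>v (?N + 1)"
    from arg_cong[OF this, of "\<lambda>v. vec_index v ?N"] show False by (simp add: u_def)
  qed
  have v0: "v j \<noteq> 0\<^sub>v (?N + 1)" for j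
  proof
    assume eq: "v j = 0\<^sub>v (?N + 1)"
    obtain k where "k < ?N" "f k = j"
      using f unfolding bij_betw_def by (metis UNIV_I atLeastLessThan_iff imageE)
    with arg_cong[OF eq, of "\<lambda>v. vec_index v k"] show False by (simp add: v_def)
  qed
  have "u i \<bullet> v j = e i j" for i j
  proof -
    have "u i \<bullet> v j = (\<Sum>k = 0..<?N. e i (f k) * (if f k = j then 1 else 0))"
      by (simp add: u_def v_def scalar_prod_def)
    also have "\<dots> = (\<Sum>l\<in>UNIV. e i l * (if l = j then 1 else 0))"
      by (rule sum.reindex_bij_betw[OF f, of "\<lambda>l. e i l * (if l = j then 1 else 0)"])
    finally show ?thesis by (simp add: if_distrib[of "(*) _"] cong: if_cong)
  qed
  then have "sign_realizes A (?N + 1) u v"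
    using u0 v0 by (auto simp: sign_realizes_def e_def u_def v_def)
  then have "\<exists>u v. sign_realizes A (?N + 1) u v" by blast
  then show ?thesis
    unfolding sign_rank_def by (rule LeastI)
qed

lemma zero_notin_realization:
  fixes A :: "('m::finite, 'n::finite) partial_sign_matrix"
  shows "0 \<notin> realization (sign_complex A)"
proof
  assume "0 \<in> realization (sign_complex A)"
  then obtain s r where s: "s \<subseteq> sigma_plus A r \<or> s \<subseteq> sigma_minus A r"
    and hull: "0 \<in> convex hull (vertex_pos ` s)"
    by (auto simp: realization_def sign_complex_def)
  define a :: "real ^ 'n" where
    "a = (\<chi> i. case A r i of Pos \<Rightarrow> 1 | Neg \<Rightarrow> -1 | Star \<Rightarrow> 0)"
  have [simp]: "inner a (axis i 1) = (case A r i of Pos \<Rightarrow> 1 | Neg \<Rightarrow> -1 | Star \<Rightarrow> 0)" for i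
    by (simp add: inner_axis a_def)
  from s obtain c :: real where "c \<noteq> 0" and sub: "vertex_pos ` s \<subseteq> {x. inner a x = c}"
  proof
    assume "s \<subseteq> sigma_plus A r"
    then have "vertex_pos ` s \<subseteq> {x. inner a x = 1}"
      by (auto simp: sigma_plus_def dest!: subsetD)
    then show thesis using that[of 1] by simp
  next
    assume "s \<subseteq> sigma_minus A r"
    then have "vertex_pos ` s \<subseteq> {x. inner a x = -1}"
      by (auto simp: sigma_minus_def dest!: subsetD)
    then show thesis using that[of "-1"] by simp
  qed
  from hull_minimal[of _ _ convex, OF sub convex_hyperplane] hull \<open>c \<noteq> 0\<close>
  show False by auto
qed

lemma lin_index_attained:
  fixes A :: "('m::finite, 'n::finite) partial_sign_matrix"
  shows "\<exists>g. linear_into (lin_index (sign_complex A) + 1) g \<and>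
           0\<^sub>v (lin_index (sign_complex A) + 1) \<notin> g ` realization (sign_complex A)"
proof -
  obtain f :: "nat \<Rightarrow> 'n" where f: "bij_betw f {0..<CARD('n)} UNIV"
    using ex_bij_betw_nat_finite[of "UNIV :: 'n set"] by auto
  define g :: "real ^ 'n \<Rightarrow> real Matrix.vec" where
    "g = (\<lambda>x. Matrix.vec CARD('n) (\<lambda>k. vec_nth x (f k)))"
  have lin: "linear_into CARD('n) g"
    by (auto simp: linear_into_def g_def)
  have "x = 0" if "g x = 0\<^sub>v CARD('n)" for x
  proof -
    have "vec_nth x (f k) = 0" if "k < CARD('n)" for k
      using arg_cong[OF \<open>g x = _\<close>, of "\<lambda>v. vec_index v k"] that by (simp add: g_def)
    moreover have "\<exists>k<CARD('n). j = f k" for j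
      using f unfolding bij_betw_def by (metis UNIV_I atLeastLessThan_iff imageE)
    ultimately show ?thesis
      by (metis Finite_Cartesian_Product.vec_eq_iff Finite_Cartesian_Product.zero_index)
  qed
  then have "0\<^sub>v CARD('n) \<notin> g ` realization (sign_complex A)"
    using zero_notin_realization[of A] by (metis imageE)
  with lin have "\<exists>g. linear_into (CARD('n) - 1 + 1) g \<and>
      0\<^sub>v (CARD('n) - 1 + 1) \<notin> g ` realization (sign_complex A)"
    by (intro exI[of _ g]) simp
  then show ?thesis
    unfolding lin_index_def by (rule LeastI)
qed

end

theory Submission
  imports Defs
begin

text \<open>
  A linear map \<open>g\<close> on \<open>real ^ 'n\<close> is the same thing as a family of vectors \<open>v j = g (axis j 1)\<close>.
  Under this dictionary, \<open>g\<close> avoids \<open>0\<close> on the simplex of row \<open>r\<close> iff the convex hull of the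
  vectors \<open>v j\<close> and \<open>- v j\<close>, with the signs prescribed by row \<open>r\<close>, misses the origin; and by convex
  separation this holds iff some \<open>u r\<close> has positive inner product with all of them, that is,
  iff row \<open>r\<close> of the sign pattern can be realized by the vectors \<open>v j\<close>. The negative simplex
  of a row is the antipode of the positive one and imposes the same condition. The resulting
  equivalence \<open>sign_realizes_iff_avoiding_map\<close> matches sign realizations in dimension \<open>d\<close>
  with linear maps into dimension \<open>d\<close>; the linear index counts a target of dimension
  \<open>d + 1\<close> as \<open>d\<close>, whence the shift by one.

  The separating vector is found inside the image of \<open>g\<close>: the point of smallest norm of a compact
  convex set that misses the origin (\<open>separating_vector_in_image\<close>).
  Rows and columns consisting of stars impose no condition on \<open>g\<close>, but a realization still has
  to assign nonzero vectors to them, which is possible as soon as \<open>d > 0\<close>.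
\<close>

lemma linear_scalar_prod_linear_into:
  assumes "linear_into d g" and "w \<in> carrier_vec d"
  shows "linear (\<lambda>x. w \<bullet> g x)"
proof (rule linearI)
  have g: "g x \<in> carrier_vec d" for x
    using assms(1) by (simp add: linear_into_def)
  show "w \<bullet> g (x + y) = w \<bullet> g x + w \<bullet> g y" for x y
    using assms g[of x] g[of y] by (simp add: linear_into_def scalar_prod_add_distrib)
  show "w \<bullet> g (c *\<^sub>R x) = c *\<^sub>R (w \<bullet> g x)" for c x
    using assms g[of x] by (simp add: linear_into_def)
qed

lemma scalar_prod_self_pos:
  fixes w :: "real Matrix.vec"
  assumes "w \<in> carrier_vec d" and "w \<noteq> 0\<^sub>v d"
  shows "w \<bullet> w > 0"
proof -
  obtain k where k: "k < d" "vec_index w k \<noteq> 0"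
    using assms by (metis carrier_vecD eq_vecI index_zero_vec)
  have "(\<Sum>i = 0..<d. vec_index w i * vec_index w i) > 0"
    using k by (intro sum_pos2[of _ k]) (auto simp: zero_less_mult_iff)
  then show ?thesis
    using assms by (simp add: scalar_prod_def)
qed

lemma exists_nonzero_vec:
  assumes "d > 0"
  shows "\<exists>w \<in> carrier_vec d. w \<noteq> (0\<^sub>v d :: real Matrix.vec)"
proof -
  have "unit_vec d 0 \<noteq> (0\<^sub>v d :: real Matrix.vec)"
    using assms by (metis index_unit_vec(2) index_zero_vec(1) zero_neq_one)
  then show ?thesis by (intro bexI[of _ "unit_vec d 0"]) simp_all
qed

text \<open>
  The separating vector is the image \<open>g p\<close> of smallest norm: if \<open>g p \<bullet> g x\<close> were not
  positive for some \<open>x\<close> in \<open>C\<close>, moving slightly from \<open>p\<close> towards \<open>x\<close> would decrease the norm of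
  the image, since \<open>g p\<close> is nonzero.
\<close>

lemma separating_vector_in_image:
  fixes C :: "(real ^ 'n::finite) set"
  assumes lin: "linear_into d g" and C: "compact C" "convex C" "C \<noteq> {}"
    and avoid: "0\<^sub>v d \<notin> g ` C"
  obtains p where "p \<in> C" "\<And>x. x \<in> C \<Longrightarrow> g p \<bullet> g x > 0"
proof -
  have g: "g x \<in> carrier_vec d" for x
    using lin by (simp add: linear_into_def)
  have coord: "continuous_on C (\<lambda>x. vec_index (g x) k)" if "k < d" for k
  proof -
    have "vec_index (g x) k = unit_vec d k \<bullet> g x" for x
      using g[of x] that by simp
    then show ?thesis
      using linear_scalar_prod_linear_into[OF lin, of "unit_vec d k"]
      by (simp add: linear_continuous_on linear_conv_bounded_linear)
  qed
  have "continuous_on C (\<lambda>x. g x \<bullet> g x)"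
    using g[THEN carrier_vecD] by (auto simp: scalar_prod_def intro!: continuous_intros coord)
  then obtain p where p: "p \<in> C" and min: "\<And>y. y \<in> C \<Longrightarrow> g p \<bullet> g p \<le> g y \<bullet> g y"
    using continuous_attains_inf[OF C(1,3)] by blast
  have pos: "g p \<bullet> g p > 0"
    using scalar_prod_self_pos[OF g] avoid p by (metis imageI)
  have "g p \<bullet> g x > 0" if "x \<in> C" for x
  proof (rule ccontr)
    assume "\<not> g p \<bullet> g x > 0"
    define a b c where "a = g p \<bullet> g p" and "b = g p \<bullet> g x" and "c = g x \<bullet> g x"
    have "a > 0" "b \<le> 0" "a \<le> c"
      using pos \<open>\<not> g p \<bullet> g x > 0\<close> min[OF that] by (auto simp: a_def b_def c_def)
    \<comment> \<open>For \<open>b \<le> 0\<close> this step size strictly decreases the squared norm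
      \<open>(1 - t)\<^sup>2 a + 2 t (1 - t) b + t\<^sup>2 c\<close> below \<open>a\<close>; for \<open>b = 0\<close> it is the minimiser.\<close>
    define t where "t = a / (a + c)"
    have t: "0 < t" "t < 1" and tac: "t * (a + c) = a"
      using \<open>a > 0\<close> \<open>a \<le> c\<close> by (auto simp: t_def)
    define y where "y = (1 - t) *\<^sub>R p + t *\<^sub>R x"
    have "y \<in> C"
      using C(2) p that t by (simp add: y_def convex_alt)
    have gy: "g y = (1 - t) \<cdot>\<^sub>v g p + t \<cdot>\<^sub>v g x"
      using lin by (simp add: y_def linear_into_def)
    have expand: "w \<bullet> g y = (1 - t) * (w \<bullet> g p) + t * (w \<bullet> g x)" if "w \<in> carrier_vec d" for w
      using that g[of p] g[of x] unfolding gy by (simp add: scalar_prod_add_distrib[of _ d])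
    have "g y \<bullet> g y = (1 - t) * (g p \<bullet> g y) + t * (g x \<bullet> g y)"
      using expand[OF g, of y] by (simp only: comm_scalar_prod[OF g[of y] g[of p]] comm_scalar_prod[OF g[of y] g[of x]])
    also have "\<dots> = (1 - t) * ((1 - t) * a + t * b) + t * ((1 - t) * b + t * c)"
      unfolding expand[OF g] comm_scalar_prod[OF g[of x] g[of p]] a_def b_def c_def ..
    also have "\<dots> = a - 2 * t * a + t * (t * (a + c)) + 2 * t * (1 - t) * b"
      by (simp add: algebra_simps)
    also have "\<dots> = a - t * a + 2 * t * (1 - t) * b"
      unfolding tac by simp
    also have "\<dots> < a"
    proof -
      have "t * a > 0" using t \<open>a > 0\<close> by simp
      moreover have "2 * t * (1 - t) * b \<le> 0"
        using t \<open>b \<le> 0\<close> by (intro mult_nonneg_nonpos) auto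
      ultimately show ?thesis by linarith
    qed
    finally show False
      using min[OF \<open>y \<in> C\<close>] by (simp add: a_def)
  qed
  then show thesis using that p by blast
qed

text \<open>
  The open half-spaces \<open>u r \<bullet> g x > 0\<close> and \<open>u r \<bullet> g x < 0\<close> contain the two simplices of row \<open>r\<close>,
  because they are convex and contain the vertices.
\<close>

lemma avoiding_map_if_sign_realizes:
  fixes A :: "('m, 'n::finite) partial_sign_matrix"
  assumes "sign_realizes A d u v"
  shows "\<exists>g. linear_into d g \<and> 0\<^sub>v d \<notin> g ` realization (sign_complex A)"
proof -
  define g where
    "g x = Matrix.vec d (\<lambda>k. \<Sum>j\<in>UNIV. vec_nth x j * vec_index (v j) k)" for x :: "real ^ 'n"
  have lin: "linear_into d g"
    by (auto simp: linear_into_def g_def sum.distrib sum_distrib_left algebra_simps)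
  have u: "u r \<in> carrier_vec d" and v: "v j \<in> carrier_vec d" for r j
    using assms by (auto simp: sign_realizes_def)
  have g_axis: "g (axis j 1) = v j" for j
    using v[of j] by (intro eq_vecI) (auto simp: g_def axis_def if_distrib[of "\<lambda>a. a * _"] cong: if_cong)
  have "g x \<noteq> 0\<^sub>v d" if x_in: "x \<in> realization (sign_complex A)" for x
  proof -
    obtain s r where s: "s \<subseteq> sigma_plus A r \<or> s \<subseteq> sigma_minus A r"
      and x: "x \<in> convex hull (vertex_pos ` s)"
      using x_in by (auto simp: realization_def sign_complex_def)
    define h where "h x = u r \<bullet> g x" for x
    have h: "linear h"
      using linear_scalar_prod_linear_into[OF lin u] unfolding h_def .
    have h_axis: "A r j = Pos \<Longrightarrow> h (axis j 1) > 0" "A r j = Neg \<Longrightarrow> h (axis j 1) < 0" for j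
      using assms by (auto simp: h_def g_axis sign_realizes_def sgn_1_pos sgn_1_neg)
    from s have "h x \<noteq> 0"
    proof
      assume "s \<subseteq> sigma_plus A r"
      then have "vertex_pos ` s \<subseteq> h -` {0<..}"
        using h_axis by (auto simp: sigma_plus_def linear_neg[OF h] dest!: subsetD)
      from hull_minimal[of _ _ convex, OF this convex_linear_vimage[OF h convex_real_interval(3)]] x
      show ?thesis by auto
    next
      assume "s \<subseteq> sigma_minus A r"
      then have "vertex_pos ` s \<subseteq> h -` {..<0}"
        using h_axis by (auto simp: sigma_minus_def linear_neg[OF h] dest!: subsetD)
      from hull_minimal[of _ _ convex, OF this convex_linear_vimage[OF h convex_real_interval(4)]] x
      show ?thesis by auto
    qed
    then show ?thesis
      using u by (auto simp: h_def)
  qed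
  with lin show ?thesis by (metis imageE)
qed

lemma convex_hull_sigma_plus_subset_realization:
  "convex hull (vertex_pos ` sigma_plus A r) \<subseteq> realization (sign_complex A)"
  by (auto simp: realization_def sign_complex_def)

text \<open>
  The vectors \<open>u r\<close> come from separating the positive simplex of row \<open>r\<close>. The vector
  \<open>g (axis j 1)\<close> can vanish only if column \<open>j\<close> consists of stars, since otherwise \<open>axis j 1\<close> or its
  antipode lies in the realization; in that case any nonzero vector serves as \<open>v j\<close>.
\<close>

lemma sign_realizes_if_avoiding_map:
  fixes A :: "('m, 'n::finite) partial_sign_matrix"
  assumes "d > 0" and lin: "linear_into d g"
    and avoid: "0\<^sub>v d \<notin> g ` realization (sign_complex A)"
  shows "\<exists>u v. sign_realizes A d u v"
proof -
  obtain w :: "real Matrix.vec" where w: "w \<in> carrier_vec d" "w \<noteq> 0\<^sub>v d"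
    using exists_nonzero_vec[OF \<open>d > 0\<close>] by blast
  have g: "g x \<in> carrier_vec d" for x
    using lin by (simp add: linear_into_def)
  have g_neg: "q \<bullet> g (- x) = - (q \<bullet> g x)" if "q \<in> carrier_vec d" for q x
    by (rule linear_neg[OF linear_scalar_prod_linear_into[OF lin that]])
  have row: "\<exists>q. q \<in> carrier_vec d \<and> q \<noteq> 0\<^sub>v d \<and>
      (\<forall>j. (A r j = Pos \<longrightarrow> q \<bullet> g (axis j 1) > 0) \<and> (A r j = Neg \<longrightarrow> q \<bullet> g (axis j 1) < 0))" for r
  proof (cases "sigma_plus A r = {}")
    case True
    then have "A r j \<noteq> Pos \<and> A r j \<noteq> Neg" for j
      by (auto simp: sigma_plus_def)
    with w show ?thesis by blast
  next
    case False
    let ?C = "convex hull (vertex_pos ` sigma_plus A r)"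
    have "finite (sigma_plus A r)"
      by (simp add: sigma_plus_def)
    moreover have "0\<^sub>v d \<notin> g ` ?C"
      using avoid convex_hull_sigma_plus_subset_realization[of A r] by blast
    ultimately obtain p where p: "p \<in> ?C" and sep: "\<And>x. x \<in> ?C \<Longrightarrow> g p \<bullet> g x > 0"
      using separating_vector_in_image[OF lin, of ?C] False
      by (auto simp: finite_imp_compact_convex_hull)
    have vertex: "g p \<bullet> g (vertex_pos s) > 0" if "s \<in> sigma_plus A r" for s
      using that by (intro sep hull_inc imageI)
    have "g p \<bullet> g (axis j 1) > 0" if "A r j = Pos" for j
      using vertex[of "Plus j"] that by (simp add: sigma_plus_def)
    moreover have "g p \<bullet> g (axis j 1) < 0" if "A r j = Neg" for j
      using vertex[of "Minus j"] that by (simp add: sigma_plus_def g_neg[OF g])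
    moreover have "g p \<noteq> 0\<^sub>v d"
      using sep[OF p] g[of p] by auto
    ultimately show ?thesis using g[of p] by blast
  qed
  obtain u where u: "\<And>r. u r \<in> carrier_vec d" "\<And>r. u r \<noteq> 0\<^sub>v d"
    and pos: "\<And>r j. A r j = Pos \<Longrightarrow> u r \<bullet> g (axis j 1) > 0"
    and neg: "\<And>r j. A r j = Neg \<Longrightarrow> u r \<bullet> g (axis j 1) < 0"
    using row by metis
  define v where "v j = (if g (axis j 1) = 0\<^sub>v d then w else g (axis j 1))" for j
  have "v j \<in> carrier_vec d \<and> v j \<noteq> 0\<^sub>v d" for j
    using w g by (simp add: v_def)
  moreover have "sgn (u r \<bullet> v j) = 1" if "A r j = Pos" for r j
    using pos[OF that] u(1)[of r] by (auto simp: v_def)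
  moreover have "sgn (u r \<bullet> v j) = - 1" if "A r j = Neg" for r j
    using neg[OF that] u(1)[of r] by (auto simp: v_def)
  ultimately have "sign_realizes A d u v"
    using u unfolding sign_realizes_def by blast
  then show ?thesis by blast
qed

lemma sign_realizes_dim_pos:
  assumes "sign_realizes A d u v"
  shows "d > 0"
proof (rule ccontr)
  assume "\<not> d > 0"
  moreover have "u i \<in> carrier_vec d" "u i \<noteq> 0\<^sub>v d" for i
    using assms by (auto simp: sign_realizes_def)
  ultimately show False by (metis carrier_vecD eq_vecI gr0I index_zero_vec(2) not_less0)
qed

lemma sign_realizes_iff_avoiding_map:
  fixes A :: "('m, 'n::finite) partial_sign_matrix"
  shows "(\<exists>u v. sign_realizes A d u v) \<longleftrightarrow>
    d > 0 \<and> (\<exists>g. linear_into d g \<and> 0\<^sub>v d \<notin> g ` realization (sign_complex A))"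
  using avoiding_map_if_sign_realizes sign_realizes_if_avoiding_map sign_realizes_dim_pos by metis

theorem lemma1:
  fixes A :: "('m::finite, 'n::finite) partial_sign_matrix"
  shows "int (lin_index (sign_complex A)) = int (sign_rank A) - 1"
proof -
  let ?Q = "\<lambda>d. \<exists>u v. sign_realizes A d u v"
  have "?Q (sign_rank A)"
    by (rule sign_rank_attained)
  moreover have "\<not> ?Q 0"
    by (simp add: sign_realizes_iff_avoiding_map)
  ultimately have "sign_rank A = Suc (LEAST d. ?Q (Suc d))"
    unfolding sign_rank_def by (rule Least_Suc)
  also have "(LEAST d. ?Q (Suc d)) = lin_index (sign_complex A)"
    by (simp add: sign_realizes_iff_avoiding_map lin_index_def)
  finally show ?thesis by simp
qed

end
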